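(* Every abelian C$^*$-algebra (that is, every space $C_0(\tilde{L})$ with $\tilde{L}$ a locally compact Hausdorff space) satisfies the complex Mazur--Ulam property.
   Context: $C_0(\tilde{L})$ is the space of all complex-valued continuous functions on $\tilde{L}$ vanishing at infinity, with the supremum norm. For a Banach space $X$, $S(X)$ denotes its unit sphere, with the metric induced by the norm. A complex Banach space $E$ satisfies the complex Mazur--Ulam property if for each complex Banach space $X$, every surjective isometry (distance-preserving map) $\Delta:S(E)\to S(X)$ admits an extension to a surjective real linear isometry $T:E\to X$. *)

theory Defs
  imports "HOL-Analysis.Analysis" "HOL-Probability.Discrete_Topology"
begin

section \<open>Complex Banach spaces\<close>

class complex_normed_vector = real_normed_vector +
  fixes scaleC :: "complex \<Rightarrow> 'a \<Rightarrow> 'a" (infixr "*\<^sub>C" 75)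
  assumes scaleC_add_right: "a *\<^sub>C (x + y) = a *\<^sub>C x + a *\<^sub>C y"
    and scaleC_add_left: "(a + b) *\<^sub>C x = a *\<^sub>C x + b *\<^sub>C x"
    and scaleC_scaleC: "a *\<^sub>C (b *\<^sub>C x) = (a * b) *\<^sub>C x"
    and scaleC_of_real: "complex_of_real r *\<^sub>C x = r *\<^sub>R x"
    and norm_scaleC: "norm (a *\<^sub>C x) = cmod a * norm x"

class complex_banach = complex_normed_vector + banach

lemma scaleC_one [simp]: "1 *\<^sub>C (x :: 'a :: complex_normed_vector) = x"
  using scaleC_of_real[of 1 x] by simp

lemma bounded_linear_scaleC: "bounded_linear (\<lambda>x :: 'a :: complex_normed_vector. c *\<^sub>C x)"
proof (rule bounded_linear_intro[where K = "cmod c"])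
  fix r and x :: 'a
  have "c *\<^sub>C (complex_of_real r *\<^sub>C x) = complex_of_real r *\<^sub>C (c *\<^sub>C x)"
    unfolding scaleC_scaleC by (simp add: mult.commute)
  then show "c *\<^sub>C (r *\<^sub>R x) = r *\<^sub>R (c *\<^sub>C x)"
    by (simp add: scaleC_of_real)
qed (simp_all add: scaleC_add_right norm_scaleC mult.commute)

instantiation complex :: complex_banach
begin

definition scaleC_complex :: "complex \<Rightarrow> complex \<Rightarrow> complex"
  where "scaleC_complex = (*)"

instance
  by standard (auto simp: scaleC_complex_def algebra_simps norm_mult scaleR_conv_of_real)

end

instantiation bcontfun :: (topological_space, complex_normed_vector) complex_normed_vector
begin

definition scaleC_bcontfun :: "complex \<Rightarrow> ('a \<Rightarrow>\<^sub>C 'b) \<Rightarrow> ('a \<Rightarrow>\<^sub>C 'b)"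
  where "scaleC_bcontfun c f = Bcontfun (\<lambda>x. c *\<^sub>C apply_bcontfun f x)"

lemma apply_bcontfun_scaleC [simp]:
  "apply_bcontfun (c *\<^sub>C f) x = c *\<^sub>C apply_bcontfun f x" for f :: "'a \<Rightarrow>\<^sub>C 'b"
proof -
  have "(\<lambda>x. c *\<^sub>C apply_bcontfun f x) \<in> bcontfun"
  proof (rule bcontfun_normI)
    show "continuous_on UNIV (\<lambda>x. c *\<^sub>C apply_bcontfun f x)"
      by (rule bounded_linear.continuous_on[OF bounded_linear_scaleC]) simp
    show "norm (c *\<^sub>C apply_bcontfun f x) \<le> cmod c * norm f" for x
      by (simp add: norm_scaleC norm_bounded mult_left_mono)
  qed
  then show ?thesis
    by (simp add: scaleC_bcontfun_def Bcontfun_inverse)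
qed

instance
proof
  fix a b :: complex and r :: real and x y :: "'a \<Rightarrow>\<^sub>C 'b"
  show "a *\<^sub>C (x + y) = a *\<^sub>C x + a *\<^sub>C y" by (rule bcontfun_eqI) (simp add: scaleC_add_right)
  show "(a + b) *\<^sub>C x = a *\<^sub>C x + b *\<^sub>C x" by (rule bcontfun_eqI) (simp add: scaleC_add_left)
  show assoc: "a *\<^sub>C (b *\<^sub>C x) = (a * b) *\<^sub>C x" for a b :: complex and x :: "'a \<Rightarrow>\<^sub>C 'b"
    by (rule bcontfun_eqI) (simp add: scaleC_scaleC)
  show real: "complex_of_real r *\<^sub>C x = r *\<^sub>R x" for r and x :: "'a \<Rightarrow>\<^sub>C 'b"
    by (rule bcontfun_eqI) (simp add: scaleC_of_real)
  have le: "norm (c *\<^sub>C z) \<le> cmod c * norm z" for c and z :: "'a \<Rightarrow>\<^sub>C 'b"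
    by (rule norm_bound) (simp add: norm_scaleC norm_bounded mult_left_mono)
  show "norm (a *\<^sub>C x) = cmod a * norm x"
  proof (cases "a = 0")
    case True
    then show ?thesis using real[of 0 x] by simp
  next
    case False
    have "x = inverse a *\<^sub>C (a *\<^sub>C x)"
      using False real[of 1 x] by (simp add: assoc)
    then have "norm x \<le> inverse (cmod a) * norm (a *\<^sub>C x)"
      using le[of "inverse a" "a *\<^sub>C x"] by (simp add: norm_inverse)
    then have "cmod a * norm x \<le> norm (a *\<^sub>C x)"
      using False by (simp add: field_simps)
    then show ?thesis using le[of a x] by simp
  qed
qed

end

instance bcontfun :: (metric_space, complex_banach) complex_banach ..

definition closed_complex_subspace :: "'a :: complex_normed_vector set \<Rightarrow> bool"
  where "closed_complex_subspace E \<longleftrightarrow>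
    closed E \<and> 0 \<in> E \<and> (\<forall>x\<in>E. \<forall>y\<in>E. x + y \<in> E) \<and> (\<forall>c. \<forall>x\<in>E. c *\<^sub>C x \<in> E)"


section \<open>The complex Mazur--Ulam property\<close>

definition surjective_isometry_on :: "('a :: metric_space \<Rightarrow> 'b :: metric_space) \<Rightarrow> 'a set \<Rightarrow> 'b set \<Rightarrow> bool"
  where "surjective_isometry_on h A B \<longleftrightarrow>
    (\<forall>x\<in>A. \<forall>y\<in>A. dist (h x) (h y) = dist x y) \<and> h ` A = B"

definition real_linear_on :: "'a :: real_vector set \<Rightarrow> ('a \<Rightarrow> 'b :: real_vector) \<Rightarrow> bool"
  where "real_linear_on E T \<longleftrightarrow>
    (\<forall>x\<in>E. \<forall>y\<in>E. T (x + y) = T x + T y) \<and> (\<forall>r. \<forall>x\<in>E. T (r *\<^sub>R x) = r *\<^sub>R T x)"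

text \<open>
  The Banach space \<open>E\<close> is given as a closed complex subspace of a complex Banach space, so that
  a family of spaces depending on a term, such as \<open>C0 L\<close> below, is covered (\<open>E = UNIV\<close> is allowed).
  HOL cannot quantify over types inside a formula: the target space \<open>X\<close> is the type \<open>'x\<close>, and the
  property of \<open>E\<close> is \<open>complex_mazur_ulam E TYPE('x)\<close> for arbitrary \<open>'x :: complex_banach\<close>.
  Maps on \<open>E\<close> or on its sphere are total functions whose values elsewhere are irrelevant.
\<close>

definition complex_mazur_ulam :: "'e :: complex_banach set \<Rightarrow> 'x :: complex_banach itself \<Rightarrow> bool"
  where "complex_mazur_ulam E X \<longleftrightarrow>
    (\<forall>\<Delta> :: 'e \<Rightarrow> 'x. surjective_isometry_on \<Delta> (E \<inter> sphere 0 1) (sphere 0 1) \<longrightarrow>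
      (\<exists>T :: 'e \<Rightarrow> 'x. real_linear_on E T \<and> surjective_isometry_on T E UNIV \<and>
        (\<forall>x \<in> E \<inter> sphere 0 1. T x = \<Delta> x)))"


section \<open>The space of continuous functions vanishing at infinity\<close>

text \<open>
  All bounded functions from \<open>'l\<close> to the complex numbers, with the supremum norm: with respect to
  the discrete topology on the domain every function is continuous.
\<close>

type_synonym 'l bounded_fun = "'l discrete \<Rightarrow>\<^sub>C complex"

definition value_at :: "'l bounded_fun \<Rightarrow> 'l \<Rightarrow> complex"
  where "value_at f x = apply_bcontfun f (discrete x)"

definition vanishes_at_infinity :: "'l topology \<Rightarrow> ('l \<Rightarrow> complex) \<Rightarrow> bool"
  where "vanishes_at_infinity L g \<longleftrightarrow> (\<forall>e>0. compactin L {x \<in> topspace L. e \<le> cmod (g x)})"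

text \<open>
  A function on \<open>topspace L\<close> is represented by its extension by zero to the type \<open>'l\<close>. Boundedness
  is automatic for continuous functions vanishing at infinity, see \<open>C0_represents\<close>; the norm is the
  supremum norm over \<open>topspace L\<close>, see \<open>norm_C0\<close>.
\<close>

definition C0 :: "'l topology \<Rightarrow> 'l bounded_fun set"
  where "C0 L = {f. continuous_map L euclidean (value_at f) \<and>
    vanishes_at_infinity L (value_at f) \<and> (\<forall>x. x \<notin> topspace L \<longrightarrow> value_at f x = 0)}"

lemma value_at_simps [simp]:
  "value_at 0 x = 0" "value_at (f + g) x = value_at f x + value_at g x"
  "value_at (c *\<^sub>C f) x = c * value_at f x"
  by (simp_all add: value_at_def scaleC_complex_def)

lemma norm_value_at_le: "cmod (value_at f x) \<le> norm f"
  by (simp add: value_at_def norm_bounded)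

lemma dist_value_at_le: "dist (value_at f x) (value_at g x) \<le> dist f g"
  by (simp add: value_at_def dist_bounded)

lemma value_at_eqI: "f = g" if "\<And>x. value_at f x = value_at g x"
proof (rule bcontfun_eqI)
  show "apply_bcontfun f y = apply_bcontfun g y" for y
    using that[of "of_discrete y"] by (simp add: value_at_def of_discrete_inverse)
qed

lemma norm_bounded_fun_le: "norm f \<le> b" if "\<And>x. cmod (value_at f x) \<le> b"
proof (rule norm_bound)
  show "cmod (apply_bcontfun f y) \<le> b" for y
    using that[of "of_discrete y"] by (simp add: value_at_def of_discrete_inverse)
qed

lemma norm_C0:
  assumes "f \<in> C0 L" "topspace L \<noteq> {}"
  shows "norm f = (SUP x\<in>topspace L. cmod (value_at f x))"
proof (rule antisym)
  have bdd: "bdd_above ((\<lambda>x. cmod (value_at f x)) ` topspace L)"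
    by (rule bdd_aboveI2) (rule norm_value_at_le)
  have up: "cmod (value_at f x) \<le> (SUP x\<in>topspace L. cmod (value_at f x))" if "x \<in> topspace L" for x
    by (rule cSUP_upper[OF that bdd])
  obtain z where "z \<in> topspace L" using assms(2) by blast
  then have nonneg: "0 \<le> (SUP x\<in>topspace L. cmod (value_at f x))"
    using up[of z] norm_ge_zero order_trans by blast
  show "norm f \<le> (SUP x\<in>topspace L. cmod (value_at f x))"
  proof (rule norm_bounded_fun_le)
    show "cmod (value_at f x) \<le> (SUP x\<in>topspace L. cmod (value_at f x))" for x
      using up[of x] nonneg assms(1) by (cases "x \<in> topspace L") (auto simp: C0_def)
  qed
  show "(SUP x\<in>topspace L. cmod (value_at f x)) \<le> norm f"
    by (rule cSUP_least) (use assms norm_value_at_le in auto)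
qed

lemma compactin_norm_ge:
  assumes "continuous_map L euclidean g" "compactin L K"
    and "{x \<in> topspace L. e \<le> cmod (g x)} \<subseteq> K"
  shows "compactin L {x \<in> topspace L. e \<le> cmod (g x)}"
proof (rule closed_compactin[OF assms(2,3)])
  have "closedin L {x \<in> topspace L. g x \<in> {z. e \<le> cmod z}}"
    by (rule closedin_continuous_map_preimage[OF assms(1)])
       (auto intro!: closed_Collect_le continuous_intros)
  then show "closedin L {x \<in> topspace L. e \<le> cmod (g x)}" by simp
qed

lemma compactin_C0: "compactin L {x \<in> topspace L. e \<le> cmod (value_at f x)}" if "f \<in> C0 L" "e > 0"
  using that by (simp add: C0_def vanishes_at_infinity_def)

lemma C0_represents:
  assumes "continuous_map L euclidean g" "vanishes_at_infinity L g"
  shows "\<exists>!f. f \<in> C0 L \<and> (\<forall>x\<in>topspace L. value_at f x = g x)"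
proof (rule ex_ex1I)
  define h where "h = (\<lambda>x. if x \<in> topspace L then g x else 0)"
  let ?K = "{x \<in> topspace L. 1 \<le> cmod (g x)}"
  have "compactin L ?K" using assms(2) by (simp add: vanishes_at_infinity_def)
  then have "compact (g ` ?K)"
    using image_compactin[OF _ assms(1)] by auto
  then obtain B where B: "\<And>x. x \<in> ?K \<Longrightarrow> cmod (g x) \<le> B"
    using compact_imp_bounded bounded_iff by (metis imageI)
  have "cmod (h x) \<le> max 1 B" for x
    using B[of x] by (cases "1 \<le> cmod (g x)") (auto simp: h_def le_max_iff_disj)
  then have "(\<lambda>y. h (of_discrete y)) \<in> bcontfun"
    by (intro bcontfun_normI) (auto simp: continuous_on_open_vimage open_discrete)
  then have v: "value_at (Bcontfun (\<lambda>y. h (of_discrete y))) = h"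
    by (auto simp: value_at_def Bcontfun_inverse discrete_inverse)
  have "continuous_map L euclidean h"
    by (rule continuous_map_eq[OF assms(1)]) (simp add: h_def)
  moreover have "vanishes_at_infinity L h"
    using assms(2) by (simp add: vanishes_at_infinity_def h_def cong: conj_cong)
  ultimately show "\<exists>f. f \<in> C0 L \<and> (\<forall>x\<in>topspace L. value_at f x = g x)"
    by (intro exI[of _ "Bcontfun (\<lambda>y. h (of_discrete y))"]) (auto simp: C0_def v, auto simp: h_def)
next
  fix f f'
  assume "f \<in> C0 L \<and> (\<forall>x\<in>topspace L. value_at f x = g x)"
    and "f' \<in> C0 L \<and> (\<forall>x\<in>topspace L. value_at f' x = g x)"
  then show "f = f'"
    by (intro value_at_eqI) (metis (mono_tags, lifting) C0_def mem_Collect_eq)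
qed

lemma closed_complex_subspace_C0: "closed_complex_subspace (C0 L)"
  unfolding closed_complex_subspace_def
proof (intro conjI ballI allI)
  have "value_at (0 :: 'a bounded_fun) = (\<lambda>_. 0)" by auto
  then show "0 \<in> C0 L"
    by (simp add: C0_def vanishes_at_infinity_def)
next
  fix f g assume f: "f \<in> C0 L" and g: "g \<in> C0 L"
  have cont: "continuous_map L euclidean (value_at (f + g))"
  proof -
    have "value_at (f + g) = (\<lambda>x. value_at f x + value_at g x)" by auto
    then show ?thesis
      using f g by (simp add: C0_def continuous_map_add)
  qed
  have "compactin L {x \<in> topspace L. e \<le> cmod (value_at (f + g) x)}" if "e > 0" for e
  proof (rule compactin_norm_ge[OF cont])
    show "compactin L ({x \<in> topspace L. e/2 \<le> cmod (value_at f x)} \<union>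
        {x \<in> topspace L. e/2 \<le> cmod (value_at g x)})"
      using f g that by (intro compactin_Un compactin_C0 half_gt_zero)
    have "e/2 \<le> cmod u \<or> e/2 \<le> cmod v" if "e \<le> cmod (u + v)" for u v
      using norm_triangle_ineq[of u v] that by linarith
    then show "{x \<in> topspace L. e \<le> cmod (value_at (f + g) x)} \<subseteq>
        {x \<in> topspace L. e/2 \<le> cmod (value_at f x)} \<union>
        {x \<in> topspace L. e/2 \<le> cmod (value_at g x)}"
      by auto
  qed
  then show "f + g \<in> C0 L"
    using cont f g by (auto simp: C0_def vanishes_at_infinity_def)
next
  fix c f assume f: "f \<in> C0 L"
  have cont: "continuous_map L euclidean (value_at (c *\<^sub>C f))"
  proof -
    have "value_at (c *\<^sub>C f) = (\<lambda>x. c * value_at f x)" by auto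
    then show ?thesis
      using f by (auto simp: C0_def continuous_map_atin intro: tendsto_mult_left)
  qed
  have "compactin L {x \<in> topspace L. e \<le> cmod (value_at (c *\<^sub>C f) x)}" if "e > 0" for e
  proof (cases "c = 0")
    case True
    then show ?thesis using that by simp
  next
    case False
    then have "{x \<in> topspace L. e \<le> cmod (value_at (c *\<^sub>C f) x)} =
        {x \<in> topspace L. e / cmod c \<le> cmod (value_at f x)}"
      by (auto simp: norm_mult field_simps)
    then show ?thesis
      using compactin_C0[OF f, of "e / cmod c"] False that by simp
  qed
  then show "c *\<^sub>C f \<in> C0 L"
    using cont f by (auto simp: C0_def vanishes_at_infinity_def)
next
  show "closed (C0 L)"
    unfolding closed_sequential_limits
  proof safe
    fix F f assume F: "\<forall>n. F n \<in> C0 L" and lim: "F \<longlonglongrightarrow> f"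
    have near: "\<forall>\<^sub>F n in sequentially. \<forall>x. dist (value_at (F n) x) (value_at f x) < e" if "e > 0" for e
      using tendstoD[OF lim that]
      by eventually_elim (meson dist_value_at_le le_less_trans)
    have cont: "continuous_map L euclidean (value_at f)"
    proof -
      have "continuous_map L (Met_TC.mtopology :: complex topology) (value_at f)"
        by (rule Met_TC.continuous_map_uniform_limit[where F = sequentially and f = "\<lambda>n. value_at (F n)"])
           (use F in \<open>auto simp: C0_def intro: eventually_mono[OF near]\<close>)
      then show ?thesis by simp
    qed
    have "compactin L {x \<in> topspace L. e \<le> cmod (value_at f x)}" if e: "e > 0" for e
    proof -
      obtain n where n: "\<And>x. dist (value_at (F n) x) (value_at f x) < e/2"
        using eventually_happens[OF near[OF half_gt_zero[OF e]]] by auto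
      show ?thesis
      proof (rule compactin_norm_ge[OF cont])
        show "compactin L {x \<in> topspace L. e/2 \<le> cmod (value_at (F n) x)}"
          using F e by (intro compactin_C0 half_gt_zero) auto
        have "e/2 \<le> cmod (value_at (F n) x)" if "e \<le> cmod (value_at f x)" for x
          using n[of x] that norm_triangle_ineq2[of "value_at f x" "value_at (F n) x"]
          by (simp add: dist_norm norm_minus_commute)
        then show "{x \<in> topspace L. e \<le> cmod (value_at f x)} \<subseteq>
            {x \<in> topspace L. e/2 \<le> cmod (value_at (F n) x)}" by auto
      qed
    qed
    moreover have "value_at f x = 0" if "x \<notin> topspace L" for x
    proof (rule ccontr)
      assume "value_at f x \<noteq> 0"
      then obtain n where "\<And>y. dist (value_at (F n) y) (value_at f y) < cmod (value_at f x)"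
        using eventually_happens[OF near[of "cmod (value_at f x)"]] by auto
      from this[of x] show False using F that by (auto simp: C0_def)
    qed
    ultimately show "f \<in> C0 L"
      using cont by (auto simp: C0_def vanishes_at_infinity_def)
  qed
qed

end

theory Submission
  imports Defs
begin

text \<open>
  Let \<open>\<Delta>\<close> be a surjective isometry from the sphere \<open>S\<close> of \<open>E = C\<^sub>0(L)\<close> onto the sphere of \<open>X\<close>.

  Two unit vectors have a sum of norm 2 iff one lies at distance 2 from the negative of the other.
  If every \<open>u\<close> at distance 2 from \<open>k\<close> is at distance 2 from \<open>h\<close>, this applies to the preimage of
  \<open>-\<Delta> k\<close>, so the midpoint of \<open>\<Delta> k\<close> and \<open>\<Delta> h\<close> has norm 1, and its preimage inherits the property
  of \<open>k\<close>. Starting with the average \<open>k\<close> of finitely many points of a convex subset \<open>C\<close> of \<open>S\<close> and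
  iterating, one sees that the convex hull of \<open>\<Delta>(C)\<close> lies in the sphere of \<open>X\<close>.

  By Hahn--Banach the image of the face \<open>F(p,1) = {f \<in> S. f p = 1}\<close> therefore lies in \<open>{\<psi> = 1}\<close> for
  a complex functional \<open>\<psi>\<close> of norm 1. The distance of \<open>f\<close> to \<open>F(p,\<lambda>)\<close> is \<open>|f p - \<lambda>|\<close>, and the
  complex structure of \<open>X\<close> gives the isometries \<open>\<Delta>\<^sup>-\<^sup>1 \<circ> (multiplication by \<mu>) \<circ> \<Delta>\<close> of \<open>S\<close>. They map
  \<open>F(p,1)\<close> into \<open>F(p,\<nu>)\<close> with \<open>\<nu>\<close> equal to \<open>\<mu>\<close> or its conjugate, the choice being the same for all
  \<open>\<mu>\<close>. Hence \<open>\<psi> = \<mu>\<close> on \<open>\<Delta>(F(p,\<nu>))\<close> and \<open>|\<psi>(\<Delta> f) \<plusminus> \<mu>| \<le> |f p \<plusminus> \<nu>|\<close>. If \<open>f p = t\<nu>\<close> with \<open>t \<ge> 0\<close>, this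
  confines \<open>\<psi>(\<Delta> f)\<close> to two discs that touch at \<open>t\<mu>\<close>. So \<open>\<psi>\<close> or its conjugate evaluates to \<open>f p\<close> at
  \<open>\<Delta> f\<close>. These real linear functionals separate the points of \<open>X\<close> and make the homogeneous
  extension of \<open>\<Delta>\<close> real linear.
\<close>

section \<open>Norming functionals of convex subsets of the sphere\<close>

definition sublinear :: "('a :: real_vector \<Rightarrow> real) \<Rightarrow> bool"
  where "sublinear q \<longleftrightarrow>
    (\<forall>x y. q (x + y) \<le> q x + q y) \<and> (\<forall>c x. 0 \<le> c \<longrightarrow> q (c *\<^sub>R x) = c * q x)"

text \<open>Using \<open>scale\<close> with the factor \<open>inverse c\<close> at
  \<open>c *\<^sub>R x\<close> yields the reverse inequality.\<close>

lemma sublinearI: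
  assumes add: "\<And>x y. q (x + y) \<le> q x + q y"
    and scale: "\<And>c x. 0 < c \<Longrightarrow> q (c *\<^sub>R x) \<le> c * q x"
    and zero: "q 0 = 0"
  shows "sublinear q"
  unfolding sublinear_def
proof (intro conjI allI impI add)
  fix c :: real and x assume "0 \<le> c"
  show "q (c *\<^sub>R x) = c * q x"
  proof (cases "c = 0")
    case True
    then show ?thesis by (simp add: zero)
  next
    case False
    then have c: "0 < c" using \<open>0 \<le> c\<close> by simp
    have "q x \<le> inverse c * q (c *\<^sub>R x)"
      using scale[of "inverse c" "c *\<^sub>R x"] c by simp
    then have "c * q x \<le> q (c *\<^sub>R x)"
      using c by (simp add: field_simps)
    then show ?thesis using scale[OF c, of x] by simp
  qed
qed

lemma sublinear_minus_le:
  assumes "sublinear q"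
  shows "- q (- x) \<le> q x"
proof -
  have "q (0 *\<^sub>R x) = 0 * q x" and "q (x + - x) \<le> q x + q (- x)"
    using assms unfolding sublinear_def by blast+
  then show ?thesis by simp
qed

text \<open>A sublinear function that is odd is linear, so only \<open>q (- y) = - q y\<close> is at
  stake. It follows by lowering \<open>q\<close> in the direction \<open>- y\<close> and invoking
  minimality.\<close>

lemma minimal_sublinear_imp_linear:
  assumes q: "sublinear q"
    and minimal: "\<And>r. sublinear r \<Longrightarrow> (\<And>x. r x \<le> q x) \<Longrightarrow> r = q"
  shows "linear q"
proof -
  have add: "q (x + y) \<le> q x + q y" and scale: "0 \<le> c \<Longrightarrow> q (c *\<^sub>R x) = c * q x" for c x y
    using q by (auto simp: sublinear_def)
  have neg: "q (- y) = - q y" for y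
  proof -
    \<comment> \<open>This is the largest sublinear minorant of \<open>q\<close> whose value at
      \<open>- y\<close> is at most \<open>- q y\<close>; the parameter \<open>t = 1\<close> gives
      that value.\<close>
    define r where "r = (\<lambda>x. INF t\<in>{0..}. q (x + t *\<^sub>R y) - t * q y)"
    have lower: "- q (- x) \<le> q (x + t *\<^sub>R y) - t * q y" if "0 \<le> t" for x t
      using add[of "x + t *\<^sub>R y" "- x"] scale[OF that, of y] by simp
    have bdd: "bdd_below ((\<lambda>t. q (x + t *\<^sub>R y) - t * q y) ` {0..})" for x
      by (rule bdd_belowI2[of _ "- q (- x)"]) (use lower in auto)
    have r_le: "r x \<le> q (x + t *\<^sub>R y) - t * q y" if "0 \<le> t" for x t
      unfolding r_def by (rule cINF_lower[OF bdd]) (use that in simp)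
    have near: "\<exists>t\<ge>0. q (x + t *\<^sub>R y) - t * q y < r x + e" if "0 < e" for x e
      using cINF_less_iff[OF _ bdd[of x], of "r x + e"] that by (auto simp: r_def)
    have "sublinear r"
    proof (rule sublinearI)
      fix u v
      show "r (u + v) \<le> r u + r v"
      proof (rule field_le_epsilon)
        fix e :: real assume "0 < e"
        then obtain s t where st: "s \<ge> 0" "q (u + s *\<^sub>R y) - s * q y < r u + e/2"
            "t \<ge> 0" "q (v + t *\<^sub>R y) - t * q y < r v + e/2"
          using near[of "e/2" u] near[of "e/2" v] by auto
        have "r (u + v) \<le> q ((u + s *\<^sub>R y) + (v + t *\<^sub>R y)) - (s + t) * q y"
          using r_le[of "s + t" "u + v"] st by (simp add: algebra_simps)
        then show "r (u + v) \<le> r u + r v + e"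
          using add[of "u + s *\<^sub>R y" "v + t *\<^sub>R y"] st by (simp add: algebra_simps)
      qed
    next
      fix c :: real and u assume c: "0 < c"
      show "r (c *\<^sub>R u) \<le> c * r u"
      proof (rule field_le_epsilon)
        fix e :: real assume "0 < e"
        then obtain t where t: "t \<ge> 0" "q (u + t *\<^sub>R y) - t * q y < r u + e/c"
          using near[of "e/c" u] c by auto
        have "r (c *\<^sub>R u) \<le> q (c *\<^sub>R (u + t *\<^sub>R y)) - (c * t) * q y"
          using r_le[of "c * t" "c *\<^sub>R u"] t c by (simp add: algebra_simps)
        also have "\<dots> = c * (q (u + t *\<^sub>R y) - t * q y)"
          using c scale[of c "u + t *\<^sub>R y"] by (simp add: algebra_simps)
        also have "\<dots> \<le> c * (r u + e/c)"
          using t c by (intro mult_left_mono) auto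
        finally show "r (c *\<^sub>R u) \<le> c * r u + e"
          using c by (simp add: algebra_simps)
      qed
    next
      have "q (0 + t *\<^sub>R y) - t * q y = 0" if "t \<in> {0..}" for t
        using that scale by simp
      then show "r 0 = 0"
        unfolding r_def by (subst INF_cong[OF refl, of _ _ "\<lambda>_. 0"]) auto
    qed
    moreover have "r x \<le> q x" for x
      using r_le[of 0 x] by simp
    ultimately have "r = q" by (rule minimal)
    then have "q (- y) \<le> - q y"
      using r_le[of 1 "- y"] scale[of 0 y] by simp
    then show ?thesis using sublinear_minus_le[OF q, of "- y"] by simp
  qed
  show ?thesis
  proof (rule linearI)
    fix x y
    show "q (x + y) = q x + q y"
      using add[of x y] add[of "- x" "- y"] neg[of x] neg[of y] neg[of "x + y"] by simp
  next
    fix c x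
    show "q (c *\<^sub>R x) = c *\<^sub>R q x"
      using scale[of c x] scale[of "- c" x] neg[of "c *\<^sub>R x"] by (cases "0 \<le> c") auto
  qed
qed

text \<open>By Zorn's lemma there is a minimal sublinear function below \<open>p\<close>. A chain is
  bounded by its pointwise infimum, which is finite since \<open>- p (- x)\<close> lies below every
  member.\<close>

lemma Hahn_Banach_sublinear:
  assumes p: "sublinear p"
  obtains \<phi> where "linear \<phi>" "\<And>x. \<phi> x \<le> p x"
proof -
  define Q where "Q = {q. sublinear q \<and> (\<forall>x. q x \<le> p x)}"
  \<comment> \<open>The order is reversed, so that a maximal element for \<open>?P\<close> is a
    minimal function.\<close>
  let ?P = "\<lambda>q r :: 'a \<Rightarrow> real. r \<le> q"
  have "partial_order_on Q (relation_of ?P Q)"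
    by (rule partial_order_on_relation_ofI) auto
  moreover have "\<exists>u\<in>Q. \<forall>q\<in>C. u \<le> q" if "C \<in> Chains (relation_of ?P Q)" for C
  proof (cases "C = {}")
    case True
    then show ?thesis using p by (auto simp: Q_def)
  next
    case False
    have sub: "C \<subseteq> Q" and total: "\<And>q r. q \<in> C \<Longrightarrow> r \<in> C \<Longrightarrow> q \<le> r \<or> r \<le> q"
      using that by (auto simp: Chains_def relation_of_def)
    define u where "u = (\<lambda>x. INF q\<in>C. q x)"
    have lower: "- p (- x) \<le> q x" if "q \<in> C" for q x
    proof -
      have "sublinear q" "q (- x) \<le> p (- x)" using that sub by (auto simp: Q_def)
      then show ?thesis using sublinear_minus_le[of q x] by simp
    qed
    have bdd: "bdd_below ((\<lambda>q. q x) ` C)" for x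
      by (rule bdd_belowI2[of _ "- p (- x)"]) (rule lower)
    have u_le: "u x \<le> q x" if "q \<in> C" for q x
      unfolding u_def by (rule cINF_lower[OF bdd that])
    have near: "\<exists>q\<in>C. q x < u x + e" if "0 < e" for x e
      using cINF_less_iff[OF False bdd[of x], of "u x + e"] that by (auto simp: u_def)
    have "sublinear u"
    proof (rule sublinearI)
      fix x y
      show "u (x + y) \<le> u x + u y"
      proof (rule field_le_epsilon)
        fix e :: real assume "0 < e"
        then obtain q r where qr: "q \<in> C" "q x < u x + e/2" "r \<in> C" "r y < u y + e/2"
          using near[of "e/2" x] near[of "e/2" y] by auto
        then obtain s where s: "s \<in> C" "s \<le> q" "s \<le> r"
          using total[of q r] by blast
        have "u (x + y) \<le> s x + s y"
        proof -
          have "s (x + y) \<le> s x + s y" using s(1) sub by (auto simp: Q_def sublinear_def)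
          then show ?thesis using u_le[OF s(1), of "x + y"] by simp
        qed
        then show "u (x + y) \<le> u x + u y + e"
          using qr le_funD[OF s(2), of x] le_funD[OF s(3), of y] by simp
      qed
    next
      fix c :: real and x assume c: "0 < c"
      show "u (c *\<^sub>R x) \<le> c * u x"
      proof (rule field_le_epsilon)
        fix e :: real assume "0 < e"
        then obtain q where q: "q \<in> C" "q x < u x + e/c"
          using near[of "e/c" x] c by auto
        have "u (c *\<^sub>R x) \<le> c * q x"
        proof -
          have "q (c *\<^sub>R x) = c * q x" using q(1) sub c by (auto simp: Q_def sublinear_def)
          then show ?thesis using u_le[OF q(1), of "c *\<^sub>R x"] by simp
        qed
        also have "\<dots> \<le> c * (u x + e/c)"
          using q c by (intro mult_left_mono) auto
        finally show "u (c *\<^sub>R x) \<le> c * u x + e"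
          using c by (simp add: algebra_simps)
      qed
    next
      have "q 0 = 0" if "q \<in> C" for q
      proof -
        have "q (0 *\<^sub>R 0) = 0 * q 0"
          using that sub unfolding Q_def sublinear_def by blast
        then show ?thesis by simp
      qed
      then show "u 0 = 0"
        unfolding u_def using False by (subst INF_cong[OF refl, of _ _ "\<lambda>_. 0"]) auto
    qed
    moreover have "u x \<le> p x" for x
    proof -
      obtain q where "q \<in> C" using False by blast
      moreover from this have "q x \<le> p x" using sub by (auto simp: Q_def)
      ultimately show ?thesis using u_le[of q x] by simp
    qed
    ultimately have "u \<in> Q" by (simp add: Q_def)
    then show ?thesis using u_le by (auto simp: le_fun_def)
  qed
  ultimately obtain m where m: "m \<in> Q" "\<And>q. q \<in> Q \<Longrightarrow> q \<le> m \<Longrightarrow> q = m"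
    using predicate_Zorn[of Q ?P] by blast
  have "linear m"
  proof (rule minimal_sublinear_imp_linear)
    show "sublinear m" using m(1) by (simp add: Q_def)
    show "r = m" if "sublinear r" "\<And>x. r x \<le> m x" for r
    proof (rule m(2))
      have "r x \<le> p x" for x
        using that(2)[of x] m(1) order_trans by (auto simp: Q_def)
      then show "r \<in> Q" using that(1) by (simp add: Q_def)
      show "r \<le> m" using that(2) by (rule le_funI)
    qed
  qed
  then show ?thesis using that m(1) by (auto simp: Q_def)
qed

lemma norming_real_functional:
  fixes K :: "'a :: real_normed_vector set"
  assumes K: "convex K" "K \<subseteq> sphere 0 1" "K \<noteq> {}"
  obtains \<phi> where "linear \<phi>" "\<And>y. \<phi> y \<le> norm y" "\<And>x. x \<in> K \<Longrightarrow> \<phi> x = 1"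
proof -
  define I where "I = {0 :: real..} \<times> K"
  define g where "g = (\<lambda>(y :: 'a) (t, x). norm (y + t *\<^sub>R x) - t :: real)"
  \<comment> \<open>Convexity of \<open>K\<close> makes \<open>q\<close> subadditive; \<open>q (- x) \<le> - 1\<close> on \<open>K\<close> forces any minorant to be 1 there.\<close>
  define q where "q = (\<lambda>y. INF i\<in>I. g y i)"
  have ne: "I \<noteq> {}" using K by (auto simp: I_def)
  have one: "norm x = 1" if "x \<in> K" for x using that K by auto
  have lower: "- norm y \<le> g y i" if "i \<in> I" for y i
  proof -
    obtain t x where i: "i = (t, x)" "0 \<le> t" "x \<in> K" using \<open>i \<in> I\<close> by (auto simp: I_def)
    have "norm (t *\<^sub>R x) \<le> norm (y + t *\<^sub>R x) + norm y"
      using norm_triangle_ineq4[of "y + t *\<^sub>R x" y] by simp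
    then show ?thesis using i one[of x] by (simp add: g_def)
  qed
  have bdd: "bdd_below (g y ` I)" for y
    by (rule bdd_belowI2[of _ "- norm y"]) (rule lower)
  have q_le: "q y \<le> norm (y + t *\<^sub>R x) - t" if "0 \<le> t" "x \<in> K" for y t x
    using cINF_lower[OF bdd, of "(t, x)" y] that by (simp add: q_def g_def I_def)
  have near: "\<exists>t\<ge>0. \<exists>x\<in>K. norm (y + t *\<^sub>R x) - t < q y + e" if "0 < e" for y e
    using cINF_less_iff[OF ne bdd[of y], of "q y + e"] that by (auto simp: q_def g_def I_def)
  have q_norm: "q y \<le> norm y" for y
    using K(3) q_le[of 0 _ y] by auto
  have "sublinear q"
  proof (rule sublinearI)
    fix u v
    show "q (u + v) \<le> q u + q v"
    proof (rule field_le_epsilon)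
      fix e :: real assume "0 < e"
      then obtain s x t y where st: "s \<ge> 0" "x \<in> K" "norm (u + s *\<^sub>R x) - s < q u + e/2"
          "t \<ge> 0" "y \<in> K" "norm (v + t *\<^sub>R y) - t < q v + e/2"
        using near[of "e/2" u] near[of "e/2" v] by auto
      \<comment> \<open>The weighted mean \<open>z\<close> makes \<open>(s + t, z)\<close> a
        competitor in the infimum for \<open>u + v\<close>; if \<open>s + t = 0\<close>, any point
        of \<open>K\<close> serves.\<close>
      obtain z where z: "z \<in> K" "(s + t) *\<^sub>R z = s *\<^sub>R x + t *\<^sub>R y"
      proof (cases "s + t = 0")
        case True
        then have "s = 0" "t = 0" using st by auto
        then show ?thesis using that[of x] st by simp
      next
        case False
        have "(s / (s + t)) *\<^sub>R x + (t / (s + t)) *\<^sub>R y \<in> K"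
          using K(1) st False by (intro convexD) (auto simp: add_divide_distrib[symmetric])
        then show ?thesis using False by (intro that) (auto simp: scaleR_add_right)
      qed
      have "q (u + v) \<le> norm ((u + v) + (s + t) *\<^sub>R z) - (s + t)"
        using q_le[of "s + t" z "u + v"] st z by simp
      also have "(u + v) + (s + t) *\<^sub>R z = (u + s *\<^sub>R x) + (v + t *\<^sub>R y)"
        using z by simp
      finally show "q (u + v) \<le> q u + q v + e"
        using norm_triangle_ineq[of "u + s *\<^sub>R x" "v + t *\<^sub>R y"] st by simp
    qed
  next
    fix c :: real and u assume c: "0 < c"
    show "q (c *\<^sub>R u) \<le> c * q u"
    proof (rule field_le_epsilon)
      fix e :: real assume "0 < e"
      then obtain t x where t: "t \<ge> 0" "x \<in> K" "norm (u + t *\<^sub>R x) - t < q u + e/c"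
        using near[of "e/c" u] c by auto
      have "q (c *\<^sub>R u) \<le> norm (c *\<^sub>R (u + t *\<^sub>R x)) - c * t"
        using q_le[of "c * t" x "c *\<^sub>R u"] t c by (simp add: algebra_simps)
      also have "\<dots> = c * (norm (u + t *\<^sub>R x) - t)"
        unfolding norm_scaleR using c by (simp add: algebra_simps)
      also have "\<dots> \<le> c * (q u + e/c)"
        using t c by (intro mult_left_mono) auto
      finally show "q (c *\<^sub>R u) \<le> c * q u + e"
        using c by (simp add: algebra_simps)
    qed
  next
    have "q 0 \<ge> 0"
      unfolding q_def using ne lower[of _ 0] by (intro cINF_greatest) auto
    then show "q 0 = 0" using q_norm[of 0] by simp
  qed
  then obtain \<phi> where \<phi>: "linear \<phi>" "\<And>y. \<phi> y \<le> q y"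
    using Hahn_Banach_sublinear by blast
  show ?thesis
  proof (rule that[OF \<phi>(1)])
    show le: "\<phi> y \<le> norm y" for y
      using \<phi>(2)[of y] q_norm[of y] by simp
    show "\<phi> x = 1" if "x \<in> K" for x
    proof -
      have "\<phi> (- x) \<le> -1"
        using \<phi>(2)[of "- x"] q_le[of 1 x "- x"] that by simp
      then show ?thesis
        using le[of x] one[OF that] linear_neg[OF \<phi>(1), of x] by simp
    qed
  qed
qed

definition complex_functional :: "('a :: complex_normed_vector \<Rightarrow> complex) \<Rightarrow> bool"
  where "complex_functional \<psi> \<longleftrightarrow>
    (\<forall>x y. \<psi> (x + y) = \<psi> x + \<psi> y) \<and> (\<forall>c x. \<psi> (c *\<^sub>C x) = c * \<psi> x) \<and> (\<forall>x. cmod (\<psi> x) \<le> norm x)"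

text \<open>A real norming functional is the real part of a complex linear one. On \<open>K\<close>
  the real part is 1 and the modulus at most 1, which leaves only the value 1.\<close>

lemma norming_complex_functional:
  fixes K :: "'a :: complex_normed_vector set"
  assumes K: "convex K" "K \<subseteq> sphere 0 1" "K \<noteq> {}"
  obtains \<psi> where "complex_functional \<psi>" "\<And>x. x \<in> K \<Longrightarrow> \<psi> x = 1"
proof -
  obtain \<phi> where \<phi>: "linear \<phi>" "\<And>y. \<phi> y \<le> norm y" "\<And>x. x \<in> K \<Longrightarrow> \<phi> x = 1"
    using norming_real_functional[OF K] by blast
  define \<psi> where "\<psi> = (\<lambda>x. Complex (\<phi> x) (- \<phi> (\<i> *\<^sub>C x)))"
  have add: "\<psi> (x + y) = \<psi> x + \<psi> y" for x y
    by (simp add: \<psi>_def scaleC_add_right linear_add[OF \<phi>(1)] complex_eq_iff)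
  have scale: "\<psi> (c *\<^sub>C x) = c * \<psi> x" for c x
  proof -
    have R: "\<phi> (complex_of_real r *\<^sub>C y) = r * \<phi> y" for r y
      by (simp add: scaleC_of_real linear_scale[OF \<phi>(1)])
    have c: "c = complex_of_real (Re c) + complex_of_real (Im c) * \<i>"
      by (simp add: complex_eq_iff)
    have "\<i> * c = complex_of_real (Re c) * \<i> + complex_of_real (- Im c)"
      by (simp add: complex_eq_iff)
    then have "\<phi> (\<i> *\<^sub>C c *\<^sub>C x) = Re c * \<phi> (\<i> *\<^sub>C x) - Im c * \<phi> x"
      unfolding scaleC_scaleC
      by (simp only: scaleC_add_left linear_add[OF \<phi>(1)] scaleC_scaleC[symmetric] R)
    moreover have "\<phi> (c *\<^sub>C x) = Re c * \<phi> x + Im c * \<phi> (\<i> *\<^sub>C x)"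
      by (subst c) (simp only: scaleC_add_left linear_add[OF \<phi>(1)] scaleC_scaleC[symmetric] R)
    ultimately show ?thesis by (simp add: \<psi>_def complex_eq_iff algebra_simps)
  qed
  have bound: "cmod (\<psi> x) \<le> norm x" for x
  proof (cases "\<psi> x = 0")
    case False
    \<comment> \<open>Rotating \<open>x\<close> by \<open>u\<close> makes the value of
      \<open>\<psi>\<close> real and nonnegative, so the bound on \<open>\<phi>\<close>
      applies.\<close>
    define u where "u = cnj (\<psi> x) / cmod (\<psi> x)"
    have "cmod u = 1" using False by (simp add: u_def norm_divide)
    have "u * \<psi> x = cmod (\<psi> x)"
      using False complex_norm_square[of "\<psi> x"]
      by (simp add: u_def power2_eq_square field_simps)
    then have "Re (\<psi> (u *\<^sub>C x)) = cmod (\<psi> x)"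
      by (simp add: scale)
    then have "cmod (\<psi> x) = \<phi> (u *\<^sub>C x)"
      by (simp add: \<psi>_def)
    also have "\<dots> \<le> norm x"
      using \<phi>(2)[of "u *\<^sub>C x"] \<open>cmod u = 1\<close> by (simp add: norm_scaleC)
    finally show ?thesis .
  qed simp
  have "\<psi> x = 1" if "x \<in> K" for x
  proof -
    have "Re (\<psi> x) = 1" using \<phi>(3)[OF that] by (simp add: \<psi>_def)
    moreover have "(cmod (\<psi> x))\<^sup>2 \<le> 1"
      using bound[of x] that K(2) by (auto intro!: power_le_one)
    ultimately show ?thesis by (simp add: cmod_power2 complex_eq_iff)
  qed
  then show ?thesis using that add scale bound by (auto simp: complex_functional_def)
qed

section \<open>Surjective isometries of spheres and convex sets\<close>

locale sphere_isometry =
  fixes D :: "'a :: real_normed_vector set" and \<Delta> :: "'a \<Rightarrow> 'b :: real_normed_vector"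
  assumes domain: "D \<subseteq> sphere 0 1"
    and isometry: "surjective_isometry_on \<Delta> D (sphere 0 1)"
begin

lemma norm_domain: "f \<in> D \<Longrightarrow> norm f = 1"
  using domain by auto

lemma dist_image: "f \<in> D \<Longrightarrow> g \<in> D \<Longrightarrow> dist (\<Delta> f) (\<Delta> g) = dist f g"
  using isometry by (simp add: surjective_isometry_on_def)

lemma norm_image: "f \<in> D \<Longrightarrow> norm (\<Delta> f) = 1"
  using isometry by (auto simp: surjective_isometry_on_def)

lemma preimage:
  assumes "norm y = 1"
  obtains f where "f \<in> D" "\<Delta> f = y"
proof -
  have "y \<in> \<Delta> ` D"
    using isometry assms by (simp add: surjective_isometry_on_def)
  then show ?thesis using that by blast
qed

text \<open>Described by distance alone, in contrast to \<open>- k\<close>, so that isometries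
  respect it.\<close>

definition antipodes :: "'a \<Rightarrow> 'a set"
  where "antipodes k = {u \<in> D. dist k u = 2}"

text \<open>The preimage of \<open>- \<Delta> k\<close> is an antipode of \<open>k\<close>, hence of
  \<open>h\<close>, so \<Delta> h is at distance 2 from \<open>- \<Delta> k\<close>.\<close>

lemma norm_add_eq_2:
  assumes "k \<in> D" "h \<in> D" "antipodes k \<subseteq> antipodes h"
  shows "norm (\<Delta> k + \<Delta> h) = 2"
proof -
  obtain g where g: "g \<in> D" "\<Delta> g = - \<Delta> k"
    using preimage[of "- \<Delta> k"] norm_image[OF assms(1)] by auto
  have "dist (\<Delta> k) (\<Delta> g) = norm (2 *\<^sub>R \<Delta> k)"
    by (simp add: g dist_norm scaleR_2)
  then have "dist k g = 2"
    using dist_image[OF assms(1) g(1)] norm_image[OF assms(1)] by simp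
  then have "dist h g = 2"
    using assms g by (auto simp: antipodes_def)
  then show ?thesis
    using dist_image[OF assms(2) g(1)] by (simp add: g dist_norm add.commute)
qed

text \<open>If the midpoint has distance 2 from \<Delta> u, so have both ends, since neither
  distance can exceed 2. The last conclusion lets \<open>m\<close> replace \<open>k\<close> when the
  construction is iterated.\<close>

lemma midpoint_preimage:
  assumes k: "k \<in> D" and h: "h \<in> D" and "antipodes k \<subseteq> antipodes h"
  obtains m where "m \<in> D" "\<Delta> m = (1/2) *\<^sub>R (\<Delta> k + \<Delta> h)" "antipodes m \<subseteq> antipodes k"
proof -
  obtain m where m: "m \<in> D" "\<Delta> m = (1/2) *\<^sub>R (\<Delta> k + \<Delta> h)"
    using preimage[of "(1/2) *\<^sub>R (\<Delta> k + \<Delta> h)"] norm_add_eq_2[OF assms] by auto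
  have "dist k u = 2" if u: "u \<in> D" "dist m u = 2" for u
  proof -
    have "norm (\<Delta> m - \<Delta> u) = 2"
      using dist_image[OF m(1) u(1)] u by (simp add: dist_norm)
    moreover have "2 *\<^sub>R (\<Delta> m - \<Delta> u) = (\<Delta> k - \<Delta> u) + (\<Delta> h - \<Delta> u)"
      by (simp add: m(2) scaleR_2 algebra_simps)
    then have "2 * norm (\<Delta> m - \<Delta> u) \<le> norm (\<Delta> k - \<Delta> u) + norm (\<Delta> h - \<Delta> u)"
      by (metis norm_triangle_ineq norm_scaleR abs_numeral)
    moreover have "norm (\<Delta> k - \<Delta> u) \<le> 2" "norm (\<Delta> h - \<Delta> u) \<le> 2"
      using norm_triangle_ineq4[of "\<Delta> k" "\<Delta> u"] norm_triangle_ineq4[of "\<Delta> h" "\<Delta> u"]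
        norm_image k h u(1) by auto
    ultimately have "norm (\<Delta> k - \<Delta> u) = 2" by simp
    then show ?thesis using dist_image[OF k u(1)] by (simp add: dist_norm)
  qed
  then show ?thesis using that m by (auto simp: antipodes_def)
qed

text \<open>Induction on \<open>H\<close>: the new point \<open>h\<close> is absorbed into
  \<open>k\<close> by passing to the preimage \<open>m\<close> of the midpoint, whose antipodes are
  still antipodes of all remaining points.\<close>

lemma norm_positive_combination:
  assumes "finite H" "H \<subseteq> D" "k \<in> D" "\<And>h. h \<in> H \<Longrightarrow> antipodes k \<subseteq> antipodes h"
    and "0 \<le> a" "\<And>h. h \<in> H \<Longrightarrow> 0 \<le> b h"
  shows "norm (a *\<^sub>R \<Delta> k + (\<Sum>h\<in>H. b h *\<^sub>R \<Delta> h)) = a + sum b H"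
  using assms
proof (induction H arbitrary: k a rule: finite_induct)
  case empty
  then show ?case by (simp add: norm_image)
next
  case (insert h H)
  obtain m where m: "m \<in> D" "\<Delta> m = (1/2) *\<^sub>R (\<Delta> k + \<Delta> h)" "antipodes m \<subseteq> antipodes k"
    using midpoint_preimage[of k h] insert.prems by auto
  \<comment> \<open>As \<open>M\<close> dominates both weights,
    \<open>(2 * M) *\<^sub>R \<Delta> m\<close> exceeds the wanted terms by nonnegative multiples of
    \<Delta> k and \<Delta> h; the norm of this excess is at most the excess of the weights.\<close>
  define M where "M = max a (b h)"
  define s where "s = (\<Sum>h\<in>H. b h *\<^sub>R \<Delta> h)"
  have b: "0 \<le> b h" using insert.prems by simp
  have "norm ((2 * M) *\<^sub>R \<Delta> m + s) = 2 * M + sum b H"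
    unfolding s_def
  proof (rule insert.IH)
    show "antipodes m \<subseteq> antipodes h'" if "h' \<in> H" for h'
      using m(3) insert.prems(3)[of h'] that by auto
  qed (use insert.prems m M_def in auto)
  moreover have "(2 * M) *\<^sub>R \<Delta> m + s
      = (a *\<^sub>R \<Delta> k + (b h *\<^sub>R \<Delta> h + s)) + ((M - a) *\<^sub>R \<Delta> k + (M - b h) *\<^sub>R \<Delta> h)"
    by (simp add: m(2) algebra_simps)
  moreover have "norm ((M - a) *\<^sub>R \<Delta> k + (M - b h) *\<^sub>R \<Delta> h) \<le> (M - a) + (M - b h)"
    using norm_triangle_ineq[of "(M - a) *\<^sub>R \<Delta> k" "(M - b h) *\<^sub>R \<Delta> h"] insert.prems
    by (simp add: norm_image M_def)
  ultimately have "a + (b h + sum b H) \<le> norm (a *\<^sub>R \<Delta> k + (b h *\<^sub>R \<Delta> h + s))"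
    using norm_triangle_ineq[of "a *\<^sub>R \<Delta> k + (b h *\<^sub>R \<Delta> h + s)"
        "(M - a) *\<^sub>R \<Delta> k + (M - b h) *\<^sub>R \<Delta> h"] by simp
  moreover have "norm s \<le> sum b H"
    unfolding s_def using insert.prems
    by (intro order_trans[OF norm_sum] sum_mono) (auto simp: norm_image subset_iff)
  then have "norm (a *\<^sub>R \<Delta> k + (b h *\<^sub>R \<Delta> h + s)) \<le> a + (b h + sum b H)"
    using norm_triangle_ineq[of "a *\<^sub>R \<Delta> k" "b h *\<^sub>R \<Delta> h + s"]
      norm_triangle_ineq[of "b h *\<^sub>R \<Delta> h" s] insert.prems b by (simp add: norm_image)
  ultimately show ?case
    using insert.hyps by (simp add: s_def)
qed

text \<open>The average \<open>k\<close> of the preimages lies in \<open>C\<close>. If it has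
  distance 2 from \<open>v\<close>, so has each of them, because an average of numbers at most 2
  reaches 2 only if all are 2.\<close>

lemma convex_hull_image_subset_sphere:
  assumes C: "convex C" "C \<subseteq> D"
  shows "convex hull (\<Delta> ` C) \<subseteq> sphere 0 1"
proof
  fix y assume "y \<in> convex hull (\<Delta> ` C)"
  then obtain K u where K: "finite K" "K \<subseteq> \<Delta> ` C" "\<And>v. v \<in> K \<Longrightarrow> 0 \<le> u v" "sum u K = 1"
      "(\<Sum>v\<in>K. u v *\<^sub>R v) = y"
    unfolding convex_hull_explicit by auto
  obtain H where H: "H \<subseteq> C" "finite H" "inj_on \<Delta> H" "K = \<Delta> ` H"
    using K(1,2) by (metis subset_image_inj finite_imageD)
  have "H \<noteq> {}" using K(4) H(4) by auto
  then have n: "0 < real (card H)" using H(2) by (simp add: card_gt_0_iff)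
  define k where "k = (\<Sum>h\<in>H. (1 / real (card H)) *\<^sub>R h)"
  have "k \<in> C"
    unfolding k_def using H n C(1) by (intro convex_sum) auto
  have sub: "antipodes k \<subseteq> antipodes h" if h: "h \<in> H" for h
  proof (clarsimp simp: antipodes_def)
    fix v assume v: "v \<in> D" "dist k v = 2"
    have le: "norm (g - v) \<le> 2" if "g \<in> H" for g
      using norm_triangle_ineq4[of g v] norm_domain v(1) that H(1) C(2) by fastforce
    have "k - v = (\<Sum>g\<in>H. (1 / real (card H)) *\<^sub>R (g - v))"
      using n by (simp add: k_def scaleR_diff_right sum_subtractf sum_constant_scaleR)
    then have "norm (k - v) \<le> (\<Sum>g\<in>H. norm ((1 / real (card H)) *\<^sub>R (g - v)))"
      by (metis norm_sum)
    also have "\<dots> = (\<Sum>g\<in>H. norm (g - v)) / real (card H)"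
      by (simp only: norm_scaleR sum_divide_distrib) simp
    finally have "2 * real (card H) \<le> (\<Sum>g\<in>H. norm (g - v))"
      using v(2) n by (simp add: dist_norm field_simps)
    moreover have "(\<Sum>g\<in>H. norm (g - v)) < (\<Sum>g\<in>H. 2)" if "norm (h - v) < 2"
      using le that h by (intro sum_strict_mono_ex1 H(2)) auto
    ultimately show "dist h v = 2"
      using le[OF h] by (fastforce simp: dist_norm)
  qed
  \<comment> \<open>The weight of \<open>k\<close> is 0: it only starts the induction.\<close>
  have "norm (0 *\<^sub>R \<Delta> k + (\<Sum>h\<in>H. u (\<Delta> h) *\<^sub>R \<Delta> h)) = 0 + (\<Sum>h\<in>H. u (\<Delta> h))"
    by (rule norm_positive_combination) (use H C K \<open>k \<in> C\<close> sub in auto)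
  then show "y \<in> sphere 0 1"
    using K(4,5) H(3,4) by (simp add: sum.reindex)
qed

end

section \<open>Faces of the unit ball of the space of functions vanishing at infinity\<close>

lemma value_at_diff [simp]: "value_at (f - g) x = value_at f x - value_at g x"
  by (simp add: value_at_def)

lemma value_at_scaleR [simp]: "value_at (r *\<^sub>R f) x = r *\<^sub>R value_at f x"
  by (simp add: value_at_def)

lemma C0_add: "f \<in> C0 L \<Longrightarrow> g \<in> C0 L \<Longrightarrow> f + g \<in> C0 L"
  and C0_scaleC: "f \<in> C0 L \<Longrightarrow> c *\<^sub>C f \<in> C0 L"
  and C0_zero: "0 \<in> C0 L"
  using closed_complex_subspace_C0[of L] by (auto simp: closed_complex_subspace_def)

lemma C0_scaleR: "f \<in> C0 L \<Longrightarrow> r *\<^sub>R f \<in> C0 L"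
  by (metis C0_scaleC scaleC_of_real)

lemma C0_diff: "f \<in> C0 L \<Longrightarrow> g \<in> C0 L \<Longrightarrow> f - g \<in> C0 L"
  using C0_add[of f L "(- 1) *\<^sub>R g"] C0_scaleR[of g L "- 1"] by simp

text \<open>Off the compact set \<open>K\<close> the modulus is at most 1/2, so the supremum 1 is a
  maximum over \<open>K\<close>.\<close>

lemma C0_norm_attained:
  assumes f: "f \<in> C0 L" "norm f = 1"
  obtains p where "p \<in> topspace L" "cmod (value_at f p) = 1"
proof -
  define K where "K = {x \<in> topspace L. 1/2 \<le> cmod (value_at f x)}"
  have small: "cmod (value_at f x) \<le> 1/2" if "x \<notin> K" for x
    using that f(1) by (cases "x \<in> topspace L") (auto simp: K_def C0_def)
  have "compactin L K"
    using compactin_C0[OF f(1), of "1/2"] by (simp add: K_def)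
  then have "compact (value_at f ` K)"
    using f(1) image_compactin[of L K euclidean "value_at f"] by (simp add: C0_def)
  then have "compact (cmod ` value_at f ` K)"
    by (intro compact_continuous_image continuous_intros)
  moreover have "K \<noteq> {}"
    using small norm_bounded_fun_le[of f "1/2"] f(2) by fastforce
  ultimately obtain p where p: "p \<in> K" "\<And>x. x \<in> K \<Longrightarrow> cmod (value_at f x) \<le> cmod (value_at f p)"
    using compact_attains_sup[of "cmod ` value_at f ` K"] by auto
  have "cmod (value_at f x) \<le> cmod (value_at f p)" for x
    using p(2)[of x] small[of x] p(1) by (cases "x \<in> K") (auto simp: K_def)
  then have "norm f \<le> cmod (value_at f p)"
    by (rule norm_bounded_fun_le)
  then have "cmod (value_at f p) = 1"
    using f(2) norm_value_at_le[of f p] by simp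
  then show ?thesis using that p(1) by (simp add: K_def)
qed

definition face :: "'l topology \<Rightarrow> 'l \<Rightarrow> complex \<Rightarrow> 'l bounded_fun set"
  where "face L p l = {f \<in> C0 L \<inter> sphere 0 1. value_at f p = l}"

lemma faceI:
  assumes "f \<in> C0 L" "norm f \<le> 1" "value_at f p = l" "cmod l = 1"
  shows "f \<in> face L p l"
  using assms norm_value_at_le[of f p] by (simp add: face_def)

lemma convex_face:
  assumes "cmod l = 1"
  shows "convex (face L p l)"
proof (rule convexI)
  fix f g and u v :: real
  assume fg: "f \<in> face L p l" "g \<in> face L p l" and uv: "0 \<le> u" "0 \<le> v" "u + v = 1"
  show "u *\<^sub>R f + v *\<^sub>R g \<in> face L p l"
  proof (rule faceI)
    show "norm (u *\<^sub>R f + v *\<^sub>R g) \<le> 1"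
      using norm_triangle_ineq[of "u *\<^sub>R f" "v *\<^sub>R g"] fg uv by (simp add: face_def)
    have "value_at (u *\<^sub>R f + v *\<^sub>R g) p = (u + v) *\<^sub>R l"
      using fg by (simp add: face_def scaleR_add_left)
    then show "value_at (u *\<^sub>R f + v *\<^sub>R g) p = l"
      using uv by simp
  qed (use fg assms in \<open>auto simp: face_def intro: C0_add C0_scaleR\<close>)
qed

text \<open>Near \<open>p\<close> the function \<open>f\<close> is deformed to the value
  \<open>l\<close> by a Urysohn function; the error is governed by the values of \<open>f\<close>
  close to \<open>p\<close>.\<close>

lemma face_near:
  assumes L: "locally_compact_space L" "Hausdorff_space L"
    and f: "f \<in> C0 L" "norm f \<le> 1" and p: "p \<in> topspace L" and l: "cmod l = 1" and e: "0 < e"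
  obtains g where "g \<in> face L p l" "dist f g \<le> cmod (value_at f p - l) + e"
proof -
  obtain U K where U: "openin L U" "compactin L K" "p \<in> U" "U \<subseteq> K"
    using L(1) p by (auto simp: locally_compact_space_def)
  have cf: "continuous_map L euclidean (value_at f)"
    using f(1) by (simp add: C0_def)
  \<comment> \<open>On \<open>W\<close> the function \<open>f\<close> varies by less than
    \<open>e\<close>, and \<open>W\<close> lies in the compact set \<open>K\<close>, so changes
    inside \<open>W\<close> do not affect vanishing at infinity.\<close>
  define W where "W = U \<inter> {x \<in> topspace L. value_at f x \<in> ball (value_at f p) e}"
  have "openin L W"
    unfolding W_def
    by (intro openin_Int U openin_continuous_map_preimage[OF cf]) simp
  then have "closedin L (topspace L - W)" by blast
  moreover have "p \<in> topspace L - (topspace L - W)"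
    using p U e by (simp add: W_def)
  moreover have "completely_regular_space L"
    using L locally_compact_regular_imp_completely_regular_space by blast
  ultimately obtain v :: "'a \<Rightarrow> real" where v: "continuous_map L (top_of_set {0..1}) v" "v p = 0"
      "v ` (topspace L - W) \<subseteq> {1}"
    unfolding completely_regular_space_def by blast
  have cv: "continuous_map L euclidean v" and v01: "\<And>x. x \<in> topspace L \<Longrightarrow> 0 \<le> v x \<and> v x \<le> 1"
    using v(1) by (auto simp: continuous_map_in_subtopology)
  \<comment> \<open>A pointwise convex combination of \<open>f\<close> and \<open>l\<close>, hence
    bounded by 1; it equals \<open>l\<close> at \<open>p\<close> and \<open>f\<close> off
    \<open>W\<close>.\<close>
  define h where "h x = value_at f x + complex_of_real (1 - v x) * (l - value_at f x)" for x
  have h_conv: "h x = v x *\<^sub>R value_at f x + (1 - v x) *\<^sub>R l" for x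
    by (simp add: h_def scaleR_conv_of_real algebra_simps)
  have ch: "continuous_map L euclidean h"
    using cf cv unfolding h_def continuous_map_atin by (auto intro!: tendsto_intros)
  have off: "h x = value_at f x" if "x \<in> topspace L - W" for x
  proof -
    have "v x = 1" using v(3) that by blast
    then show ?thesis by (simp add: h_def)
  qed
  have "vanishes_at_infinity L h"
    unfolding vanishes_at_infinity_def
  proof (intro allI impI)
    fix d :: real assume "0 < d"
    show "compactin L {x \<in> topspace L. d \<le> cmod (h x)}"
    proof (rule compactin_norm_ge[OF ch])
      show "compactin L (K \<union> {x \<in> topspace L. d \<le> cmod (value_at f x)})"
        using U compactin_C0[OF f(1) \<open>0 < d\<close>] by (intro compactin_Un)
      have "h x = value_at f x" if "x \<in> topspace L" "x \<notin> K" for x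
        using off[of x] that U(4) by (auto simp: W_def)
      then show "{x \<in> topspace L. d \<le> cmod (h x)} \<subseteq> K \<union> {x \<in> topspace L. d \<le> cmod (value_at f x)}"
        by auto
    qed
  qed
  then obtain g where g: "g \<in> C0 L" "\<And>x. x \<in> topspace L \<Longrightarrow> value_at g x = h x"
    using C0_represents[OF ch] by blast
  have outside: "value_at k x = 0" if "k \<in> C0 L" "x \<notin> topspace L" for k x
    using that by (simp add: C0_def)
  have "g \<in> face L p l"
  proof (rule faceI)
    show "norm g \<le> 1"
    proof (rule norm_bounded_fun_le)
      fix x
      show "cmod (value_at g x) \<le> 1"
      proof (cases "x \<in> topspace L")
        case True
        have "cmod (h x) \<le> v x * cmod (value_at f x) + (1 - v x) * 1"
          unfolding h_conv using norm_triangle_ineq[of "v x *\<^sub>R value_at f x" "(1 - v x) *\<^sub>R l"]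
            v01[OF True] l by simp
        also have "\<dots> \<le> v x * 1 + (1 - v x) * 1"
          using v01[OF True] f(2) norm_value_at_le[of f x]
          by (intro add_mono mult_left_mono) auto
        finally show ?thesis using g(2)[OF True] by simp
      qed (simp add: outside[OF g(1)])
    qed
  qed (use g p v(2) l in \<open>auto simp: h_def\<close>)
  moreover have "dist f g \<le> cmod (value_at f p - l) + e"
    unfolding dist_norm
  proof (rule norm_bounded_fun_le)
    fix x
    have "cmod (value_at f x - value_at g x) \<le> cmod (value_at f p - l) + e"
    proof (cases "x \<in> topspace L")
      case True
      have eq: "cmod (value_at f x - value_at g x) = (1 - v x) * cmod (l - value_at f x)"
        using g(2)[OF True] v01[OF True] unfolding h_def
        by (simp add: norm_mult del: of_real_diff)
      show ?thesis
      proof (cases "x \<in> W")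
        case True
        then have "cmod (l - value_at f x) \<le> cmod (value_at f p - l) + e"
          using norm_triangle_ineq[of "value_at f p - value_at f x" "l - value_at f p"]
          by (auto simp: W_def dist_norm norm_minus_commute)
        moreover have "(1 - v x) * cmod (l - value_at f x) \<le> 1 * cmod (l - value_at f x)"
          using v01[OF \<open>x \<in> topspace L\<close>] by (intro mult_right_mono) auto
        ultimately show ?thesis using eq by simp
      next
        case False
        then show ?thesis
          using off[of x] g(2)[OF True] True e by (simp add: add_nonneg_nonneg)
      qed
    next
      case False
      then show ?thesis using outside[OF g(1)] outside[OF f(1)] e by simp
    qed
    then show "cmod (value_at (f - g) x) \<le> cmod (value_at f p - l) + e" by simp
  qed
  ultimately show ?thesis by (rule that)
qed

lemma face_nonempty:
  assumes "locally_compact_space L" "Hausdorff_space L" "p \<in> topspace L" "cmod l = 1"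
  shows "face L p l \<noteq> {}"
  using face_near[OF assms(1,2) C0_zero _ assms(3,4), of 1] by auto

section \<open>Evaluating functionals at images of functions\<close>

text \<open>After division by \<open>l\<close>, the point \<open>u\<close> has the same distance to
  1 as \<open>a\<close> and is no closer to -1. Together with \<open>cmod u \<le> 1\<close> this
  gives \<open>Re u = Re a\<close> and then \<open>Im u\<close> up to sign.\<close>

lemma dist_antipodal_points_determine:
  assumes z: "cmod z \<le> 1" and l: "cmod l = 1" and a: "cmod a = 1"
    and minus: "cmod (z - l) \<le> cmod (a - 1)" and plus: "cmod (a + 1) \<le> cmod (z + l)"
    and minus': "cmod (a - 1) \<le> cmod (z - l)"
  shows "z = l * a \<or> z = l * cnj a"
proof -
  define u where "u = z * cnj l"
  have ll: "l * cnj l = 1"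
    using l complex_norm_square[of l] by simp
  have zu: "z = l * u"
    using ll by (simp add: u_def mult.commute mult.left_commute)
  have u: "cmod u \<le> 1" "cmod (z - l) = cmod (u - 1)" "cmod (z + l) = cmod (u + 1)"
    using z l norm_mult[of l "u - 1"] norm_mult[of l "u + 1"]
    by (simp_all add: zu norm_mult algebra_simps)
  have "(cmod u)\<^sup>2 \<le> 1" "(cmod a)\<^sup>2 = 1" "(cmod (a + 1))\<^sup>2 \<le> (cmod (u + 1))\<^sup>2"
      "(cmod (u - 1))\<^sup>2 = (cmod (a - 1))\<^sup>2"
    using u a minus plus minus' by (auto simp: power_le_one intro: power_mono)
  then have *: "(Re u)\<^sup>2 + (Im u)\<^sup>2 \<le> 1" "(Re a)\<^sup>2 + (Im a)\<^sup>2 = 1" "Re a \<le> Re u"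
      "(Re u)\<^sup>2 + (Im u)\<^sup>2 - 2 * Re u = (Re a)\<^sup>2 + (Im a)\<^sup>2 - 2 * Re a"
    by (simp_all add: cmod_power2 power2_diff power2_sum)
  then have Re: "Re u = Re a" by linarith
  have "(Im u)\<^sup>2 = (Im a)\<^sup>2"
    using *(2,4) unfolding Re by linarith
  with Re have "(Im u)\<^sup>2 = (Im a)\<^sup>2 \<and> Re u = Re a" by simp
  then show ?thesis
    by (auto simp: zu complex_eq_iff power2_eq_iff)
qed

text \<open>The radii add up to 2, the distance of the centres \<open>m\<close> and
  \<open>- m\<close>, so the discs meet in one point.\<close>

lemma tangent_discs_unique_point:
  assumes m: "cmod m = 1" and "cmod (w - m) \<le> 1 - t" "cmod (w + m) \<le> 1 + t"
  shows "w = complex_of_real t * m"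
proof -
  define u where "u = w * cnj m"
  have mm: "m * cnj m = 1"
    using m complex_norm_square[of m] by simp
  have w: "w = u * m"
    using mm by (simp add: u_def mult.commute mult.left_commute)
  have "cmod (u - 1) = cmod (w - m)" "cmod (u + 1) = cmod (w + m)"
    using m norm_mult[of "u - 1" m] norm_mult[of "u + 1" m] by (simp_all add: w algebra_simps)
  then have le: "cmod (u - 1) \<le> 1 - t" "cmod (u + 1) \<le> 1 + t"
    using assms by simp_all
  have "Re u = t"
    using le abs_Re_le_cmod[of "u - 1"] abs_Re_le_cmod[of "u + 1"] by simp
  moreover have "(cmod (u - 1))\<^sup>2 \<le> (1 - t)\<^sup>2"
    using le(1) by (intro power_mono) auto
  ultimately have "Im u = 0"
    by (simp add: cmod_power2 power2_commute)
  then show ?thesis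
    using \<open>Re u = t\<close> by (simp add: w complex_eq_iff)
qed

text \<open>The first inequality says \<open>Im m \<ge> 0\<close>, the second
  \<open>Im m \<le> 0\<close>. This will exclude conjugating at some non-real \<open>m\<close> but
  not at \<open>\<i>\<close>, or conversely.\<close>

lemma cnj_eq_self_of_dist_ii:
  assumes "cmod (m - \<i>) \<le> cmod (cnj m - \<i>)" "cmod (m + \<i>) \<le> cmod (cnj m + \<i>)"
  shows "cnj m = m"
proof -
  have "(cmod (m - \<i>))\<^sup>2 \<le> (cmod (cnj m - \<i>))\<^sup>2" "(cmod (m + \<i>))\<^sup>2 \<le> (cmod (cnj m + \<i>))\<^sup>2"
    using assms by (auto intro: power_mono)
  then show ?thesis
    by (simp add: cmod_power2 power2_diff power2_sum complex_eq_iff)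
qed

section \<open>The rotations of the sphere of X, carried back to the sphere of C0(L)\<close>

locale C0_sphere_isometry =
  fixes L :: "'l topology" and \<Delta> :: "'l bounded_fun \<Rightarrow> 'x :: complex_banach"
  assumes locally_compact: "locally_compact_space L" and Hausdorff: "Hausdorff_space L"
    and C0_isometry: "surjective_isometry_on \<Delta> (C0 L \<inter> sphere 0 1) (sphere 0 1)"
begin

abbreviation S :: "'l bounded_fun set"
  where "S \<equiv> C0 L \<inter> sphere 0 1"

sublocale sphere_isometry S \<Delta>
  using C0_isometry by unfold_locales auto

lemma face_subset: "face L p l \<subseteq> S"
  by (auto simp: face_def)

lemma faceD: "f \<in> face L p l \<Longrightarrow> f \<in> S \<and> value_at f p = l"
  by (simp add: face_def)

lemma inj_Delta: "f \<in> S \<Longrightarrow> g \<in> S \<Longrightarrow> \<Delta> f = \<Delta> g \<Longrightarrow> f = g"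
  using dist_image[of f g] by simp

text \<open>Scalar multiplication in the target, conjugated by \<Delta>. It need not be
  multiplication by \<open>a\<close> on functions, since conjugates may appear.\<close>

definition rotate :: "complex \<Rightarrow> 'l bounded_fun \<Rightarrow> 'l bounded_fun"
  where "rotate a f = inv_into S \<Delta> (a *\<^sub>C \<Delta> f)"

lemma rotate:
  assumes "cmod a = 1" "f \<in> S"
  shows "rotate a f \<in> S" "\<Delta> (rotate a f) = a *\<^sub>C \<Delta> f"
proof -
  have "a *\<^sub>C \<Delta> f \<in> \<Delta> ` S"
    using C0_isometry norm_image[OF assms(2)] assms(1)
    by (simp add: surjective_isometry_on_def norm_scaleC)
  then show "rotate a f \<in> S" "\<Delta> (rotate a f) = a *\<^sub>C \<Delta> f"
    unfolding rotate_def by (rule inv_into_into, rule f_inv_into_f)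
qed

text \<open>The convex hull of the image of the face stays in the sphere, so it has a norming
  functional.\<close>

lemma functional_of_face:
  assumes p: "p \<in> topspace L" and l: "cmod l = 1"
  obtains \<psi> where "complex_functional \<psi>" "\<And>f. f \<in> face L p l \<Longrightarrow> \<psi> (\<Delta> f) = 1"
proof -
  have "convex hull (\<Delta> ` face L p l) \<subseteq> sphere 0 1"
    by (rule convex_hull_image_subset_sphere[OF convex_face[OF l] face_subset])
  moreover have "convex hull (\<Delta> ` face L p l) \<noteq> {}"
    using face_nonempty[OF locally_compact Hausdorff p l] by simp
  ultimately obtain \<psi> where "complex_functional \<psi>" "\<And>y. y \<in> convex hull (\<Delta> ` face L p l) \<Longrightarrow> \<psi> y = 1"
    using norming_complex_functional[OF convex_convex_hull] by blast
  then show ?thesis using that by (simp add: hull_inc)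
qed

text \<open>Compare \<open>f\<close> with a nearly closest \<open>g\<close> in the face: \<Delta>
  keeps the distance and \<psi> does not increase it.\<close>

lemma functional_dist_le:
  assumes \<psi>: "complex_functional \<psi>" and p: "p \<in> topspace L" and n: "cmod n = 1"
    and face: "\<And>g. g \<in> face L p n \<Longrightarrow> \<psi> (\<Delta> g) = m" and f: "f \<in> S"
  shows "cmod (\<psi> (\<Delta> f) - m) \<le> cmod (value_at f p - n)"
proof (rule field_le_epsilon)
  fix e :: real assume "0 < e"
  then obtain g where g: "g \<in> face L p n" "dist f g \<le> cmod (value_at f p - n) + e"
    using face_near[OF locally_compact Hausdorff _ _ p n, of f e] f by auto
  have "\<psi> (\<Delta> f - \<Delta> g) + \<psi> (\<Delta> g) = \<psi> (\<Delta> f)"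
    using \<psi> unfolding complex_functional_def by (metis diff_add_cancel)
  then have "\<psi> (\<Delta> f) - m = \<psi> (\<Delta> f - \<Delta> g)"
    using face[OF g(1)] by (simp add: algebra_simps)
  then have "cmod (\<psi> (\<Delta> f) - m) \<le> norm (\<Delta> f - \<Delta> g)"
    using \<psi> by (simp add: complex_functional_def)
  also have "\<dots> = dist f g"
    using dist_image[OF f, of g] faceD[OF g(1)] by (simp add: dist_norm)
  finally show "cmod (\<psi> (\<Delta> f) - m) \<le> cmod (value_at f p - n) + e"
    using g(2) by simp
qed

text \<open>The functional of the face takes the value \<open>a\<close> at the rotated image, which
  bounds the distance below; the displacement \<open>(a - 1) *\<^sub>C \<Delta> f\<close> bounds it
  above.\<close>

lemma rotate_value_dist:
  assumes p: "p \<in> topspace L" and l: "cmod l = 1" and a: "cmod a = 1" and f: "f \<in> face L p l"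
  shows "cmod (value_at (rotate a f) p - l) = cmod (a - 1)"
proof (rule antisym)
  obtain \<psi> where \<psi>: "complex_functional \<psi>" "\<And>f. f \<in> face L p l \<Longrightarrow> \<psi> (\<Delta> f) = 1"
    using functional_of_face[OF p l] by blast
  have fS: "f \<in> S" "value_at f p = l" using faceD[OF f] by auto
  note r = rotate[OF a fS(1)]
  have "cmod (\<psi> (\<Delta> (rotate a f)) - 1) \<le> cmod (value_at (rotate a f) p - l)"
    by (rule functional_dist_le[OF \<psi>(1) p l \<psi>(2) r(1)])
  then show "cmod (a - 1) \<le> cmod (value_at (rotate a f) p - l)"
    using \<psi>(1) \<psi>(2)[OF f] r(2) by (simp add: complex_functional_def)
  have "cmod (value_at (rotate a f) p - l) \<le> dist (rotate a f) f"
    using dist_value_at_le[of "rotate a f" p f] fS by (simp add: dist_norm)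
  also have "\<dots> = norm ((a - 1) *\<^sub>C \<Delta> f)"
    using dist_image[OF r(1) fS(1)] r(2) scaleC_add_left[of "a - 1" 1 "\<Delta> f"]
    by (simp add: dist_norm)
  also have "\<dots> = cmod (a - 1)"
    using norm_image[OF fS(1)] by (simp add: norm_scaleC)
  finally show "cmod (value_at (rotate a f) p - l) \<le> cmod (a - 1)" .
qed

lemma cmod_value_le: "f \<in> S \<Longrightarrow> cmod (value_at f p) \<le> 1"
  using norm_value_at_le[of f p] by simp

lemma rotate_minus_face:
  assumes p: "p \<in> topspace L" and l: "cmod l = 1" and f: "f \<in> face L p l"
  shows "rotate (- 1) f \<in> face L p (- l)"
proof -
  have r: "rotate (- 1) f \<in> S"
    using rotate(1)[of "- 1" f] faceD[OF f] by simp
  have "value_at (rotate (- 1) f) p = - l"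
    using dist_antipodal_points_determine[OF cmod_value_le[OF r] l, of "- 1" p]
      rotate_value_dist[OF p l _ f, of "- 1"] by simp
  then show ?thesis using r by (simp add: face_def)
qed

text \<open>Rotation by -1 interchanges opposite faces, and \<psi> changes sign under it.\<close>

lemma functional_on_opposite_face:
  assumes \<psi>: "complex_functional \<psi>" and p: "p \<in> topspace L" and n: "cmod n = 1"
    and face: "\<And>g. g \<in> face L p n \<Longrightarrow> \<psi> (\<Delta> g) = m" and f: "f \<in> face L p (- n)"
  shows "\<psi> (\<Delta> f) = - m"
proof -
  have "rotate (- 1) f \<in> face L p n"
    using rotate_minus_face[OF p _ f] n by simp
  then have "\<psi> ((- 1) *\<^sub>C \<Delta> f) = m"
    using face[of "rotate (- 1) f"] rotate(2)[of "- 1" f] faceD[OF f] by simp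
  then have "- \<psi> (\<Delta> f) = m" using \<psi> by (simp add: complex_functional_def)
  then show ?thesis by (metis minus_minus)
qed

text \<open>The opposite face, where \<psi> is -1, supplies the missing bound on the distance to
  \<open>- l\<close>.\<close>

lemma rotate_value:
  assumes p: "p \<in> topspace L" and l: "cmod l = 1" and a: "cmod a = 1" and f: "f \<in> face L p l"
  shows "value_at (rotate a f) p = l * a \<or> value_at (rotate a f) p = l * cnj a"
proof -
  obtain \<psi> where \<psi>: "complex_functional \<psi>" "\<And>f. f \<in> face L p l \<Longrightarrow> \<psi> (\<Delta> f) = 1"
    using functional_of_face[OF p l] by blast
  have r: "rotate a f \<in> S" "\<Delta> (rotate a f) = a *\<^sub>C \<Delta> f"
    using rotate[OF a, of f] faceD[OF f] by auto
  have "cmod (\<psi> (\<Delta> (rotate a f)) - (- 1)) \<le> cmod (value_at (rotate a f) p - (- l))"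
    by (rule functional_dist_le[OF \<psi>(1) p _ _ r(1)])
       (use l functional_on_opposite_face[OF \<psi>(1) p l \<psi>(2)] in auto)
  then have "cmod (a + 1) \<le> cmod (value_at (rotate a f) p + l)"
    using \<psi>(1) \<psi>(2)[OF f] r(2) by (simp add: complex_functional_def)
  then show ?thesis
    using dist_antipodal_points_determine[OF cmod_value_le[OF r(1)] l a]
      rotate_value_dist[OF p l a f] by simp
qed

lemma rotate_value_constant:
  assumes p: "p \<in> topspace L" and l: "cmod l = 1" and a: "cmod a = 1"
    and f: "f \<in> face L p l" and g: "g \<in> face L p l"
  shows "value_at (rotate a f) p = value_at (rotate a g) p"
proof -
  \<comment> \<open>The value depends continuously on the function, is one of two numbers, and the face is connected.\<close>
  let ?v = "\<lambda>f. value_at (rotate a f) p"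
  have "continuous_on (face L p l) ?v"
  proof (rule continuous_onI)
    fix h e assume h: "h \<in> face L p l" and e: "(0 :: real) < e"
    have "dist (?v k) (?v h) \<le> e" if k: "k \<in> face L p l" "dist k h < e" for k
    proof -
      have S: "h \<in> S" "k \<in> S" using h k faceD by auto
      have "dist (?v k) (?v h) \<le> dist (rotate a k) (rotate a h)"
        by (rule dist_value_at_le)
      also have "\<dots> = dist (a *\<^sub>C \<Delta> k) (a *\<^sub>C \<Delta> h)"
        using rotate[OF a] S dist_image by metis
      also have "\<dots> = dist k h"
        using dist_image[OF S(2,1)] a
        by (simp add: dist_norm norm_scaleC flip: linear_diff[OF bounded_linear.linear[OF bounded_linear_scaleC]])
      finally show ?thesis using k(2) by simp
    qed
    then show "\<exists>d>0. \<forall>k\<in>face L p l. dist k h < d \<longrightarrow> dist (?v k) (?v h) \<le> e"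
      using e by blast
  qed
  moreover have "finite (?v ` face L p l)"
    by (rule finite_subset[of _ "{l * a, l * cnj a}"]) (use rotate_value[OF p l a] in auto)
  ultimately have "?v constant_on face L p l"
    using convex_connected[OF convex_face[OF l]] by (intro continuous_finite_range_constant)
  then show ?thesis using f g by (auto simp: constant_on_def)
qed

text \<open>One function \<open>f0\<close> determines \<open>n\<close>. Rotation by
  \<open>cnj m\<close> returns \<open>rotate m f0\<close> to \<open>f0\<close>, so by constancy of
  the rotated value it sends all of \<open>face L p n\<close> into \<open>face L p 1\<close>, where
  \<psi> is 1.\<close>

lemma functional_on_face:
  assumes p: "p \<in> topspace L"
    and \<psi>: "complex_functional \<psi>" "\<And>f. f \<in> face L p 1 \<Longrightarrow> \<psi> (\<Delta> f) = 1" and m: "cmod m = 1"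
  obtains n where "n = m \<or> n = cnj m" "\<And>f. f \<in> face L p n \<Longrightarrow> \<psi> (\<Delta> f) = m"
proof -
  obtain f0 where f0: "f0 \<in> face L p 1"
    using face_nonempty[OF locally_compact Hausdorff p, of 1] by auto
  define n where "n = value_at (rotate m f0) p"
  have n: "n = m \<or> n = cnj m"
    using rotate_value[OF p _ m f0] by (simp add: n_def)
  then have n1: "cmod n = 1" and m': "cmod (cnj m) = 1" using m by auto
  have mm: "m * cnj m = 1"
    using m complex_norm_square[of m] by simp
  have f0S: "f0 \<in> S" "value_at f0 p = 1" using faceD[OF f0] by auto
  note r = rotate[OF m f0S(1)]
  note r' = rotate[OF m' r(1)]
  have "rotate m f0 \<in> face L p n"
    using r by (simp add: face_def n_def)
  have "rotate (cnj m) (rotate m f0) = f0"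
    by (rule inj_Delta[OF r'(1) f0S(1)])
       (simp add: r'(2) r(2) scaleC_scaleC mm mult.commute[of "cnj m"])
  have "\<psi> (\<Delta> h) = m" if h: "h \<in> face L p n" for h
  proof -
    have hS: "h \<in> S" using faceD[OF h] by simp
    have "value_at (rotate (cnj m) h) p = value_at (rotate (cnj m) (rotate m f0)) p"
      by (rule rotate_value_constant[OF p n1 m' h]) fact
    then have "rotate (cnj m) h \<in> face L p 1"
      using \<open>rotate (cnj m) (rotate m f0) = f0\<close> f0S rotate(1)[OF m' hS] by (simp add: face_def)
    then have "cnj m * \<psi> (\<Delta> h) = 1"
      using \<psi>(2)[of "rotate (cnj m) h"] rotate(2)[OF m' hS] \<psi>(1) by (simp add: complex_functional_def)
    then have "m * cnj m * \<psi> (\<Delta> h) = m" by (simp add: mult.assoc)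
    then show ?thesis by (simp add: mm)
  qed
  then show ?thesis using that n by blast
qed

text \<open>The distances of \<open>t * n\<close> to \<open>n\<close> and \<open>- n\<close> are
  \<open>1 - t\<close> and \<open>1 + t\<close>, the radii of two tangent discs around
  \<open>m\<close> and \<open>- m\<close>.\<close>

lemma functional_value_determined:
  assumes p: "p \<in> topspace L" and \<psi>: "complex_functional \<psi>"
    and n: "cmod n = 1" and m: "cmod m = 1"
    and face: "\<And>g. g \<in> face L p n \<Longrightarrow> \<psi> (\<Delta> g) = m"
    and f: "f \<in> S" and t: "0 \<le> t" "value_at f p = complex_of_real t * n"
  shows "\<psi> (\<Delta> f) = complex_of_real t * m"
proof (rule tangent_discs_unique_point[OF m])
  have t1: "t \<le> 1"
    using cmod_value_le[OF f, of p] t n by (simp add: norm_mult)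
  have "cmod (value_at f p - n) = cmod (complex_of_real (t - 1) * n)"
    using t by (simp add: algebra_simps)
  then have "cmod (value_at f p - n) = 1 - t"
    using n t1 by (simp only: norm_mult norm_of_real) simp
  then show "cmod (\<psi> (\<Delta> f) - m) \<le> 1 - t"
    using functional_dist_le[OF \<psi> p n face f] by simp
  have "cmod (value_at f p - (- n)) = cmod (complex_of_real (t + 1) * n)"
    using t by (simp add: algebra_simps)
  then have "cmod (value_at f p - (- n)) = 1 + t"
    using n t(1) by (simp only: norm_mult norm_of_real) simp
  moreover have "cmod (\<psi> (\<Delta> f) - (- m)) \<le> cmod (value_at f p - (- n))"
    by (rule functional_dist_le[OF \<psi> p _ _ f])
       (use n functional_on_opposite_face[OF \<psi> p n face] in auto)
  ultimately show "cmod (\<psi> (\<Delta> f) + m) \<le> 1 + t" by simp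
qed

lemma evaluation_functional:
  assumes p: "p \<in> topspace L"
  obtains \<theta> where "linear \<theta>" "\<And>f. f \<in> S \<Longrightarrow> \<theta> (\<Delta> f) = value_at f p"
proof -
  obtain \<psi> where \<psi>: "complex_functional \<psi>" "\<And>f. f \<in> face L p 1 \<Longrightarrow> \<psi> (\<Delta> f) = 1"
    using functional_of_face[OF p, of 1] by auto
  \<comment> \<open>The alternative found at \<open>\<i>\<close> decides whether \<kappa> is the
    identity or conjugation.\<close>
  obtain j where j: "j = \<i> \<or> j = cnj \<i>" "\<And>f. f \<in> face L p j \<Longrightarrow> \<psi> (\<Delta> f) = \<i>"
    using functional_on_face[OF p \<psi>, of \<i>] by auto
  then have j1: "cmod j = 1" by auto
  define \<kappa> where "\<kappa> = (if j = \<i> then (\<lambda>z. z) else cnj)"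
  have \<kappa>: "\<kappa> (\<kappa> z) = z" "cmod (\<kappa> z) = cmod z" "\<kappa> (complex_of_real t * z) = complex_of_real t * \<kappa> z" for z t
    by (simp_all add: \<kappa>_def)
  have face_value: "\<psi> (\<Delta> f) = m" if m: "cmod m = 1" and f: "f \<in> face L p (\<kappa> m)" for m f
  proof -
    obtain n where n: "n = m \<or> n = cnj m" "\<And>f. f \<in> face L p n \<Longrightarrow> \<psi> (\<Delta> f) = m"
      using functional_on_face[OF p \<psi> m] by blast
    have n1: "cmod n = 1" using n(1) m by auto
    obtain g where g: "g \<in> face L p n"
      using face_nonempty[OF locally_compact Hausdorff p n1] by auto
    then have gS: "g \<in> S" "value_at g p = n" using faceD by auto
    \<comment> \<open>Comparing with the faces for \<open>j\<close> and \<open>- j\<close> shows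
      that \<open>m\<close> follows the same alternative as \<open>\<i>\<close>, unless
      \<open>m\<close> is real and the alternatives coincide.\<close>
    have "cmod (m - \<i>) \<le> cmod (n - j)"
      using functional_dist_le[OF \<psi>(1) p j1 j(2) gS(1)] n(2)[OF g] gS by simp
    moreover have "cmod (\<psi> (\<Delta> g) - (- \<i>)) \<le> cmod (value_at g p - (- j))"
      by (rule functional_dist_le[OF \<psi>(1) p _ _ gS(1)])
         (use j1 functional_on_opposite_face[OF \<psi>(1) p j1 j(2)] in auto)
    then have "cmod (m + \<i>) \<le> cmod (n + j)"
      using n(2)[OF g] gS by simp
    ultimately have "n = \<kappa> m"
      using n(1) j(1) cnj_eq_self_of_dist_ii[of m] complex_mod_cnj[of "m - \<i>"] complex_mod_cnj[of "m + \<i>"]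
      by (auto simp: \<kappa>_def)
    then show ?thesis using n(2) f by simp
  qed
  have psi_value: "\<psi> (\<Delta> f) = \<kappa> (value_at f p)" if f: "f \<in> S" for f
  proof -
    define t where "t = cmod (value_at f p)"
    \<comment> \<open>Polar decomposition of the value; for \<open>t = 0\<close> the direction is
      arbitrary.\<close>
    define n where "n = (if t = 0 then 1 else value_at f p / t)"
    have n: "cmod n = 1" "value_at f p = complex_of_real t * n"
      by (auto simp: n_def t_def norm_divide)
    have "\<psi> (\<Delta> f) = complex_of_real t * \<kappa> n"
    proof (rule functional_value_determined[OF p \<psi>(1) n(1)])
      show "\<psi> (\<Delta> g) = \<kappa> n" if "g \<in> face L p n" for g
        using face_value[of "\<kappa> n" g] that n(1) by (simp add: \<kappa>)
    qed (use n f \<kappa> in \<open>auto simp: t_def\<close>)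
    then show ?thesis by (simp add: n(2) \<kappa>)
  qed
  have "linear (\<lambda>y. \<kappa> (\<psi> y))"
  proof (rule linearI)
    show "\<kappa> (\<psi> (x + y)) = \<kappa> (\<psi> x) + \<kappa> (\<psi> y)" for x y
      using \<psi>(1) by (simp add: complex_functional_def \<kappa>_def)
    show "\<kappa> (\<psi> (r *\<^sub>R x)) = r *\<^sub>R \<kappa> (\<psi> x)" for r x
      using \<psi>(1) by (simp add: complex_functional_def scaleR_conv_of_real \<kappa> flip: scaleC_of_real)
  qed
  then show ?thesis
    by (rule that) (use psi_value \<kappa> in auto)
qed

lemma linear_extension:
  "\<exists>T. real_linear_on (C0 L) T \<and> surjective_isometry_on T (C0 L) UNIV \<and> (\<forall>f\<in>S. T f = \<Delta> f)"
proof -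
  have "\<forall>p\<in>topspace L. \<exists>\<theta>. linear \<theta> \<and> (\<forall>f\<in>S. \<theta> (\<Delta> f) = value_at f p)"
    using evaluation_functional by metis
  then obtain \<theta> where \<theta>: "\<And>p. p \<in> topspace L \<Longrightarrow> linear (\<theta> p)"
      "\<And>p f. p \<in> topspace L \<Longrightarrow> f \<in> S \<Longrightarrow> \<theta> p (\<Delta> f) = value_at f p"
    by metis
  \<comment> \<open>The normalised difference of two distinct points is some \<Delta> f, and
    \<open>f\<close> has modulus 1 at some \<open>p\<close>, so \<theta> at \<open>p\<close> does
    not annihilate the difference.\<close>
  have separating: "y = z" if eq: "\<And>p. p \<in> topspace L \<Longrightarrow> \<theta> p y = \<theta> p z" for y z
  proof (rule ccontr)
    assume "y \<noteq> z"
    then obtain f where f: "f \<in> S" "\<Delta> f = sgn (y - z)"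
      using preimage[of "sgn (y - z)"] by (auto simp: norm_sgn)
    obtain p where p: "p \<in> topspace L" "cmod (value_at f p) = 1"
      using C0_norm_attained[of f L] f(1) by auto
    have "\<theta> p (\<Delta> f) = 0"
      using eq[OF p(1)] linear_scale[OF \<theta>(1)[OF p(1)]] linear_diff[OF \<theta>(1)[OF p(1)]]
      by (simp add: f(2) sgn_div_norm)
    then show False using \<theta>(2)[OF p(1) f(1)] p(2) by simp
  qed
  \<comment> \<open>The homogeneous extension; the factor \<open>norm f\<close> makes it 0 at 0. Its
    linearity is checked through the separating functionals, which turn \<open>T f\<close> into the
    values of \<open>f\<close>.\<close>
  define T where "T = (\<lambda>f. norm f *\<^sub>R \<Delta> (sgn f))"
  have sgn_S: "sgn f \<in> S" if "f \<in> C0 L" "f \<noteq> 0" for f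
    using that by (simp add: norm_sgn sgn_div_norm C0_scaleR)
  have \<theta>_T: "\<theta> p (T f) = value_at f p" if "p \<in> topspace L" "f \<in> C0 L" for p f
  proof (cases "f = 0")
    case False
    then show ?thesis
      using \<theta>(2)[OF that(1) sgn_S[OF that(2)]] linear_scale[OF \<theta>(1)[OF that(1)]]
      by (simp add: T_def sgn_div_norm)
  qed (simp add: T_def linear_0[OF \<theta>(1)[OF that(1)]])
  have norm_T: "norm (T f) = norm f" if "f \<in> C0 L" for f
    using norm_image[OF sgn_S[OF that]] by (cases "f = 0") (auto simp: T_def)
  have add: "T (f + g) = T f + T g" if "f \<in> C0 L" "g \<in> C0 L" for f g
    by (rule separating) (simp add: \<theta>_T that C0_add linear_add[OF \<theta>(1)])
  have scale: "T (r *\<^sub>R f) = r *\<^sub>R T f" if "f \<in> C0 L" for r f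
    by (rule separating) (simp add: \<theta>_T that C0_scaleR linear_scale[OF \<theta>(1)])
  have diff: "T f - T g = T (f - g)" if "f \<in> C0 L" "g \<in> C0 L" for f g
    by (rule separating) (simp add: \<theta>_T that C0_diff linear_diff[OF \<theta>(1)])
  have "dist (T f) (T g) = dist f g" if "f \<in> C0 L" "g \<in> C0 L" for f g
    using norm_T[OF C0_diff[OF that]] by (simp add: dist_norm diff[OF that])
  moreover have extends: "T f = \<Delta> f" if "f \<in> S" for f
    using that by (simp add: T_def sgn_div_norm)
  moreover have "y \<in> T ` C0 L" for y
  proof (cases "y = 0")
    case True
    then show ?thesis using C0_zero[of L] by (intro image_eqI[of _ _ 0]) (auto simp: T_def)
  next
    case False
    then obtain f where f: "f \<in> S" "\<Delta> f = sgn y"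
      using preimage[of "sgn y"] by (auto simp: norm_sgn)
    then have "y = T (norm y *\<^sub>R f)"
      using False extends[OF f(1)] scale[of f "norm y"] by (simp add: sgn_div_norm)
    then show ?thesis using C0_scaleR f(1) by blast
  qed
  ultimately show ?thesis
    using add scale by (intro exI[of _ T]) (auto simp: real_linear_on_def surjective_isometry_on_def)
qed

end

theorem corollary3p2:
  fixes L :: "'l topology"
  assumes "locally_compact_space L" and "Hausdorff_space L"
  shows "complex_mazur_ulam (C0 L) TYPE('x :: complex_banach)"
  unfolding complex_mazur_ulam_def
proof (intro allI impI)
  fix \<Delta> :: "'l bounded_fun \<Rightarrow> 'x"
  assume "surjective_isometry_on \<Delta> (C0 L \<inter> sphere 0 1) (sphere 0 1)"
  then interpret C0_sphere_isometry L \<Delta>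
    using assms by unfold_locales
  show "\<exists>T. real_linear_on (C0 L) T \<and> surjective_isometry_on T (C0 L) UNIV \<and>
      (\<forall>f\<in>C0 L \<inter> sphere 0 1. T f = \<Delta> f)"
    by (rule linear_extension)
qed

end
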